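(* Let $d\ge1$. Let $\mathcal{L}:[0,\infty)\to[1,\infty)$ be monotone increasing with $\mathcal{L}(0)=1$ and $M:=1+\int_0^\infty\frac{dt}{(t+1)\mathcal{L}(t)}<\infty$, and suppose that $(t+1)\ln\mathcal{L}(t)$ is convex on $[0,\infty)$. Let $\gamma,\tilde\gamma>0$ be such that the set $\mathcal{S}(1,\mathcal{L};\gamma,\tilde\gamma M)$ contains an admissible univariate cutoff function $\hat a$ of type (a) with $0\le\hat a(t)\le1$; fix such an $\hat a$. (a) If $\hat A(t)=\prod_{j=1}^d\hat a(t_j)$, then $\hat A$ is an admissible cutoff function of second kind and type (a), and $\hat A\in\mathcal{S}(d,\mathcal{L};\gamma,\tilde\gamma M)$. (b) If $\hat B(t)=\prod_{j=1}^d\hat a(t_j)-\prod_{j=1}^d\hat a(2t_j)$, then $\hat B$ is an admissible cutoff function of second kind and type (b), and $\hat B\in\mathcal{S}(d,\mathcal{L};2\gamma,2\tilde\gamma M)$. (c) If, with $\hat A(t)=\prod_{j=1}^d\hat a(t_j)$, $\hat C$ is defined on $[0,\infty)^d$ by $$\hat C(t)=\begin{cases}0,&t\in\frac12\mathcal{B}_\infty,\\ \cos\big(\frac\pi2\hat A(2t)\big),&t\in\mathcal{B}_\infty\setminus\frac12\mathcal{B}_\infty,\\ \sin\big(\frac\pi2\hat A(t)\big),&t\in2\mathcal{B}_\infty\setminus\mathcal{B}_\infty,\\ 0,&t\notin2\mathcal{B}_\infty,\end{cases}$$ then $\hat C$ is admissible of second kind and type (c), and $\hat C\in\mathcal{S}(d,\mathcal{L};1,(\pi\gamma+2)\tilde\gamma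 M)$.
   Context: $\mathcal{B}_p=\{t\in[0,\infty)^d:\|t\|_p\le1\}$ for $p=1,\infty$. For $d\ge1$ and $\gamma,\bar\gamma>0$, $\mathcal{S}(d,\mathcal{L};\gamma,\bar\gamma)$ is the set of all $\hat A\in C^\infty[0,\infty)^d$ with $\|\hat A\|_\infty\le\gamma$ and $\frac1{k!}\|D_j^k\hat A\|_\infty\le\gamma(\bar\gamma\mathcal{L}(k-1))^k$ for all $k\in\mathbb{N}$, $1\le j\le d$, where $D_j^k=\partial^k/\partial t_j^k$. A univariate function $\hat a\in C^\infty[0,\infty)$ is admissible if $\operatorname{supp}\hat a\subset[0,2]$ and $\hat a^{(m)}(0)=0$ for $m\ge1$; it is of type (a) if in addition $\hat a(t)=1$ for $t\in[0,1]$. Let $\operatorname{proj}_k t$ denote $t\in\mathbb{R}^d$ with its $k$th coordinate replaced by $0$. A function $\hat A\in C^\infty[0,\infty)^d$ is an admissible cutoff function of second kind and type (a), (b) or (c) if $\operatorname{supp}\hat A\subset[0,2]^d$, $\hat A(t)=\hat A(\operatorname{proj}_k t)$ for every $t\in[0,\infty)^d$ and every $k$ such that $t_k\le\frac12\|t\|_\infty$, and, respectively: (a) $\hat A(t)=1$ if $t\in\mathcal{B}_1$; (b) $\hat A(t)=0$ if $t\in\frac12\mathcal{B}_1$; (c) $\hat A$ is of type (b) and $\sum_{j=0}^\infty|\hat A(2^{-j}t)|^2=1$ for $t\in[0,\infty)^d\setminus[0,1)^d$. *)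

theory Defs
  imports "HOL-Analysis.Analysis"
begin

text \<open>
  Throughout, \<open>\<real>\<^sup>d\<close> is a type of class \<open>euclidean_space\<close> with coordinates \<open>t \<bullet> b\<close>, \<open>b \<in> Basis\<close>;
  the case \<open>d = 1\<close> is the type \<open>real\<close> itself, where \<open>Basis = {1}\<close>. A function on \<open>[0,\<infinity>)\<^sup>d\<close> is
  represented by a total function, and only its values on the orthant are ever used.
\<close>

definition orthant :: "'a::euclidean_space set" where
  "orthant = {t. \<forall>b\<in>Basis. 0 \<le> t \<bullet> b}"

definition unit_ball_1 :: "'a::euclidean_space set" where
  "unit_ball_1 = {t \<in> orthant. (\<Sum>b\<in>Basis. \<bar>t \<bullet> b\<bar>) \<le> 1}"

definition unit_ball_inf :: "'a::euclidean_space set" where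
  "unit_ball_inf = {t \<in> orthant. infnorm t \<le> 1}"

text \<open>The point \<open>t + (s - t \<bullet> b) *\<^sub>R b\<close> is \<open>t\<close> with its coordinate \<open>b\<close> replaced by \<open>s\<close>. The
  derivative is taken within \<open>[0,\<infinity>)\<close>, so it is one-sided on the face \<open>t \<bullet> b = 0\<close>.\<close>

definition partial_deriv :: "'a::euclidean_space \<Rightarrow> ('a \<Rightarrow> real) \<Rightarrow> 'a \<Rightarrow> real" where
  "partial_deriv b f t =
     vector_derivative (\<lambda>s. f (t + (s - t \<bullet> b) *\<^sub>R b)) (at (t \<bullet> b) within {0..})"

text \<open>\<open>C\<^sup>\<infinity>\<close> up to the boundary: the iterated partial derivatives of all orders, taken in any
  order of the variables, exist and are continuous on the closed orthant.\<close>

definition smooth_on_orthant :: "('a::euclidean_space \<Rightarrow> real) \<Rightarrow> bool" where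
  "smooth_on_orthant f \<longleftrightarrow>
     (\<forall>bs. set bs \<subseteq> Basis \<longrightarrow>
        continuous_on orthant (foldr partial_deriv bs f) \<and>
        (\<forall>b\<in>Basis. \<forall>t\<in>orthant.
           (\<lambda>s. foldr partial_deriv bs f (t + (s - t \<bullet> b) *\<^sub>R b))
             differentiable (at (t \<bullet> b) within {0..})))"

definition sup_norm :: "('a::euclidean_space \<Rightarrow> real) \<Rightarrow> ereal" where
  "sup_norm f = (SUP t\<in>orthant. ereal \<bar>f t\<bar>)"

definition smooth_class ::
    "(real \<Rightarrow> real) \<Rightarrow> real \<Rightarrow> real \<Rightarrow> ('a::euclidean_space \<Rightarrow> real) set" where
  "smooth_class L \<gamma> \<beta> =
     {f. smooth_on_orthant f \<and> sup_norm f \<le> ereal \<gamma> \<and>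
         (\<forall>k\<ge>1. \<forall>b\<in>Basis.
            ereal (1 / fact k) * sup_norm ((partial_deriv b ^^ k) f)
              \<le> ereal (\<gamma> * (\<beta> * L (real k - 1)) ^ k))}"

definition admissible_univariate :: "(real \<Rightarrow> real) \<Rightarrow> bool" where
  "admissible_univariate a \<longleftrightarrow>
     smooth_on_orthant a \<and> closure (support_on {0..} a) \<subseteq> {0..2} \<and>
     (\<forall>m\<ge>1. (partial_deriv 1 ^^ m) a 0 = 0)"

definition admissible_univariate_a :: "(real \<Rightarrow> real) \<Rightarrow> bool" where
  "admissible_univariate_a a \<longleftrightarrow> admissible_univariate a \<and> (\<forall>t\<in>{0..1}. a t = 1)"

definition coord_proj :: "'a::euclidean_space \<Rightarrow> 'a \<Rightarrow> 'a" where
  "coord_proj b t = t - (t \<bullet> b) *\<^sub>R b"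

definition second_kind :: "('a::euclidean_space \<Rightarrow> real) \<Rightarrow> bool" where
  "second_kind A \<longleftrightarrow>
     smooth_on_orthant A \<and>
     closure (support_on orthant A) \<subseteq> cbox 0 (2 *\<^sub>R One) \<and>
     (\<forall>t\<in>orthant. \<forall>b\<in>Basis. t \<bullet> b \<le> 1/2 * infnorm t \<longrightarrow> A t = A (coord_proj b t))"

definition second_kind_a :: "('a::euclidean_space \<Rightarrow> real) \<Rightarrow> bool" where
  "second_kind_a A \<longleftrightarrow> second_kind A \<and> (\<forall>t\<in>unit_ball_1. A t = 1)"

definition second_kind_b :: "('a::euclidean_space \<Rightarrow> real) \<Rightarrow> bool" where
  "second_kind_b A \<longleftrightarrow> second_kind A \<and> (\<forall>t\<in>(*\<^sub>R) (1/2) ` unit_ball_1. A t = 0)"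

definition second_kind_c :: "('a::euclidean_space \<Rightarrow> real) \<Rightarrow> bool" where
  "second_kind_c A \<longleftrightarrow>
     second_kind_b A \<and>
     (\<forall>t \<in> orthant - {t \<in> orthant. \<forall>b\<in>Basis. t \<bullet> b < 1}.
        (\<lambda>j. \<bar>A ((1 / 2 ^ j) *\<^sub>R t)\<bar>\<^sup>2) sums 1)"

end

theory Submission
  imports Defs
begin

text \<open>
  All three functions come from the tensor products \<open>P_c t = \<Prod>b. a (c * (t \<bullet> b))\<close>, and the key
  observation is that on the orthant \<open>C = sin (\<pi>/2 B)\<close> with \<open>B = P_1 - P_2\<close> (\<open>sin_band_cases\<close>).
  Indeed \<open>P_1 = 1\<close> on the unit ball of the maximum norm and \<open>P_2 = 0\<close> outside its interior, so the
  four cases in the definition of \<open>C\<close> merge into one formula. Smoothness of \<open>C\<close> then holds because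
  smooth functions are closed under products, differences and sines
  (\<open>trig_algebra_smooth\<close>), and \<open>C\<close> inherits from \<open>B\<close> the zeros and the independence of small
  coordinates.

  The derivative bounds concern one coordinate direction at a time. There \<open>P_c\<close> is a function of one
  variable times a constant in \<open>[0,1]\<close>, which gives part (a). At every point
  the derivatives in a fixed direction of \<open>P_1\<close> or those of \<open>P_2\<close> vanish, since \<open>a\<close> is constant
  on \<open>[0,1]\<close> and on \<open>[2,\<infinity>)\<close>; so \<open>B\<close> satisfies the same derivative bounds as \<open>P_2\<close>
  (\<open>taylor_coeff_band\<close>), which is more than part (b) asks for. For part (c), the coefficients of
  \<open>sin \<circ> h\<close> and \<open>cos \<circ> h\<close> are bounded by a joint induction along the Cauchy product
  (\<open>taylor_coeff_sin_cos_bound\<close>): a bound \<open>c (r L (k - 1))^k\<close> for \<open>h\<close> becomes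
  \<open>((1 + c) r L (k - 1))^k\<close>. With \<open>h = \<pi>/2 B\<close> this is the stated constant.

  The identity \<open>\<Sum>j. C (2^(-j) t)\<^sup>2 = 1\<close> for \<open>infnorm t \<ge> 1\<close> comes from a telescoping sum of values of \<open>sin\<^sup>2 (\<pi>/2 P)\<close> along
  dyadic dilations (\<open>band_partition_of_unity\<close>).
\<close>

section \<open>Partial derivatives on the orthant\<close>

abbreviation upd :: "'a::euclidean_space \<Rightarrow> 'a \<Rightarrow> real \<Rightarrow> 'a" where
  "upd t b s \<equiv> t + (s - t \<bullet> b) *\<^sub>R b"

lemma inner_upd:
  assumes "b \<in> Basis" "b' \<in> Basis"
  shows "upd t b s \<bullet> b' = (if b' = b then s else t \<bullet> b')"
  using assms by (auto simp: inner_add_left inner_Basis)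

lemma upd_in_orthant: "t \<in> orthant \<Longrightarrow> b \<in> Basis \<Longrightarrow> 0 \<le> s \<Longrightarrow> upd t b s \<in> orthant"
  unfolding orthant_def using inner_upd[of b] by auto

lemma orthant_real: "(orthant :: real set) = {0..}"
  by (auto simp: orthant_def)

lemma orthant_inner: "t \<in> orthant \<Longrightarrow> b \<in> Basis \<Longrightarrow> 0 \<le> t \<bullet> b"
  by (simp add: orthant_def)

lemma orthant_scaleR: "t \<in> orthant \<Longrightarrow> 0 \<le> c \<Longrightarrow> c *\<^sub>R t \<in> orthant"
  by (simp add: orthant_def)

text \<open>
  A relational form of \<open>partial_deriv\<close>: it carries existence together with the value, so the
  calculus rules for one-sided real derivatives transfer to it without side conditions on
  differentiability.
\<close>

definition has_partial_deriv ::
    "'a::euclidean_space \<Rightarrow> ('a \<Rightarrow> real) \<Rightarrow> ('a \<Rightarrow> real) \<Rightarrow> bool" where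
  "has_partial_deriv b f g \<longleftrightarrow>
     (\<forall>t\<in>orthant. ((\<lambda>s. f (upd t b s)) has_real_derivative g t) (at (t \<bullet> b) within {0..}))"

lemma has_partial_derivD:
  "has_partial_deriv b f g \<Longrightarrow> t \<in> orthant \<Longrightarrow>
     ((\<lambda>s. f (upd t b s)) has_real_derivative g t) (at (t \<bullet> b) within {0..})"
  by (simp add: has_partial_deriv_def)

lemma at_within_halfline_nontrivial: "0 \<le> x \<Longrightarrow> at x within {0::real..} \<noteq> bot"
proof -
  assume "0 \<le> x"
  hence "x islimpt {x..x + 1}" "{x..x + 1} \<subseteq> {0..}" by (auto simp: islimpt_Icc)
  hence "x islimpt {0::real..}" by (rule islimpt_subset)
  thus ?thesis by (simp add: trivial_limit_within)
qed

lemma partial_deriv_eqI: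
  assumes "has_partial_deriv b f g" "t \<in> orthant" "b \<in> Basis"
  shows "partial_deriv b f t = g t"
  unfolding partial_deriv_def
  using has_partial_derivD[OF assms(1,2)] orthant_inner[OF assms(2,3)]
  by (intro vector_derivative_within at_within_halfline_nontrivial)
     (auto simp: has_real_derivative_iff_has_vector_derivative)

text \<open>
  A line through a point of the orthant in a coordinate direction, restricted to nonnegative values
  of that coordinate, stays in the orthant. Hence values off the orthant never influence a derivative.
\<close>

lemma has_partial_deriv_cong:
  assumes "has_partial_deriv b f g" "b \<in> Basis"
    and "\<And>t. t \<in> orthant \<Longrightarrow> f' t = f t" "\<And>t. t \<in> orthant \<Longrightarrow> g' t = g t"
  shows "has_partial_deriv b f' g'"
  unfolding has_partial_deriv_def
proof
  fix t :: 'a assume t: "t \<in> orthant"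
  have "((\<lambda>s. f (upd t b s)) has_real_derivative g' t) (at (t \<bullet> b) within {0..})"
    using has_partial_derivD[OF assms(1) t] assms(4)[OF t] by simp
  thus "((\<lambda>s. f' (upd t b s)) has_real_derivative g' t) (at (t \<bullet> b) within {0..})"
    by (rule has_field_derivative_transform_within[where d = 1])
       (use t assms(2,3) in \<open>auto intro!: assms(3)[symmetric] upd_in_orthant orthant_inner\<close>)
qed

lemma has_partial_deriv_const: "has_partial_deriv b (\<lambda>t. c) (\<lambda>t. 0)"
  by (simp add: has_partial_deriv_def)

lemma has_partial_deriv_add:
  "has_partial_deriv b f f' \<Longrightarrow> has_partial_deriv b g g' \<Longrightarrow>
     has_partial_deriv b (\<lambda>t. f t + g t) (\<lambda>t. f' t + g' t)"
  unfolding has_partial_deriv_def by (auto intro!: DERIV_add)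

lemma has_partial_deriv_diff:
  "has_partial_deriv b f f' \<Longrightarrow> has_partial_deriv b g g' \<Longrightarrow>
     has_partial_deriv b (\<lambda>t. f t - g t) (\<lambda>t. f' t - g' t)"
  unfolding has_partial_deriv_def by (auto intro!: DERIV_diff)

lemma has_partial_deriv_sum:
  "(\<And>i. i \<in> I \<Longrightarrow> has_partial_deriv b (f i) (f' i)) \<Longrightarrow>
     has_partial_deriv b (\<lambda>t. \<Sum>i\<in>I. f i t) (\<lambda>t. \<Sum>i\<in>I. f' i t)"
  unfolding has_partial_deriv_def by (auto intro!: DERIV_sum)

lemma has_partial_deriv_mult:
  assumes "has_partial_deriv b f f'" "has_partial_deriv b g g'"
  shows "has_partial_deriv b (\<lambda>t. f t * g t) (\<lambda>t. f' t * g t + f t * g' t)"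
  unfolding has_partial_deriv_def
proof
  fix t :: 'a assume t: "t \<in> orthant"
  show "((\<lambda>s. f (upd t b s) * g (upd t b s)) has_real_derivative f' t * g t + f t * g' t)
          (at (t \<bullet> b) within {0..})"
    using DERIV_mult[OF has_partial_derivD[OF assms(1) t] has_partial_derivD[OF assms(2) t]]
    by (simp add: mult_ac)
qed

lemma has_partial_deriv_compose:
  assumes "has_partial_deriv b f f'" "\<And>x. (\<phi> has_real_derivative \<phi>' x) (at x)"
  shows "has_partial_deriv b (\<lambda>t. \<phi> (f t)) (\<lambda>t. \<phi>' (f t) * f' t)"
  unfolding has_partial_deriv_def
proof
  fix t :: 'a assume t: "t \<in> orthant"
  show "((\<lambda>s. \<phi> (f (upd t b s))) has_real_derivative \<phi>' (f t) * f' t)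
          (at (t \<bullet> b) within {0..})"
    using DERIV_chain2[OF assms(2) has_partial_derivD[OF assms(1) t]] by simp
qed

lemma has_partial_deriv_sin:
  "has_partial_deriv b f f' \<Longrightarrow> has_partial_deriv b (\<lambda>t. sin (f t)) (\<lambda>t. cos (f t) * f' t)"
  by (rule has_partial_deriv_compose) (auto intro: DERIV_sin)

lemma has_partial_deriv_cos:
  "has_partial_deriv b f f' \<Longrightarrow> has_partial_deriv b (\<lambda>t. cos (f t)) (\<lambda>t. - sin (f t) * f' t)"
  by (rule has_partial_deriv_compose) (auto intro: DERIV_cos)

section \<open>A coinduction principle for smoothness\<close>

lemma smooth_on_orthant_continuous: "smooth_on_orthant f \<Longrightarrow> continuous_on orthant f"
  unfolding smooth_on_orthant_def by (drule spec[of _ "[]"]) simp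

lemma smooth_on_orthant_has_partial_deriv:
  assumes "smooth_on_orthant f" "b \<in> Basis"
  shows "has_partial_deriv b f (partial_deriv b f)"
  unfolding has_partial_deriv_def
proof
  fix t :: 'a assume t: "t \<in> orthant"
  have "(\<lambda>s. f (upd t b s)) differentiable (at (t \<bullet> b) within {0..})"
    using assms(1)[unfolded smooth_on_orthant_def, rule_format, of "[]"] assms(2) t by simp
  thus "((\<lambda>s. f (upd t b s)) has_real_derivative partial_deriv b f t) (at (t \<bullet> b) within {0..})"
    unfolding partial_deriv_def has_real_derivative_iff_has_vector_derivative
    by (simp add: vector_derivative_works)
qed

lemma smooth_on_orthant_partial_deriv:
  assumes "smooth_on_orthant f" "b \<in> Basis"
  shows "smooth_on_orthant (partial_deriv b f)"
  unfolding smooth_on_orthant_def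
proof (intro allI impI)
  fix bs assume "set bs \<subseteq> (Basis :: 'a set)"
  hence "set (bs @ [b]) \<subseteq> Basis" using assms(2) by simp
  from assms(1)[unfolded smooth_on_orthant_def, rule_format, OF this]
  show "continuous_on orthant (foldr partial_deriv bs (partial_deriv b f)) \<and>
        (\<forall>b'\<in>Basis. \<forall>t\<in>orthant.
           (\<lambda>s. foldr partial_deriv bs (partial_deriv b f) (upd t b' s))
             differentiable (at (t \<bullet> b') within {0..}))"
    by simp
qed

text \<open>
  Smoothness quantifies over all words of partial derivatives. It follows once the function sits in
  a family of continuous functions that is stable under every partial derivative: along any word the
  iterated derivative then agrees on the orthant with a member of the family.
\<close>

lemma smooth_on_orthant_coinduct:
  assumes "f \<in> F"
    and "\<And>g. g \<in> F \<Longrightarrow> continuous_on orthant g"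
    and "\<And>g b. g \<in> F \<Longrightarrow> b \<in> Basis \<Longrightarrow> \<exists>h\<in>F. has_partial_deriv b g h"
  shows "smooth_on_orthant f"
proof -
  have rep: "\<exists>g\<in>F. \<forall>t\<in>orthant. foldr partial_deriv bs f t = g t" if "set bs \<subseteq> Basis" for bs
    using that
  proof (induction bs)
    case Nil
    show ?case using assms(1) by auto
  next
    case (Cons b bs)
    then obtain g where g: "g \<in> F" "\<forall>t\<in>orthant. foldr partial_deriv bs f t = g t" by auto
    obtain h where h: "h \<in> F" "has_partial_deriv b g h"
      using assms(3)[OF g(1), of b] Cons.prems by auto
    have "has_partial_deriv b (foldr partial_deriv bs f) h"
      by (rule has_partial_deriv_cong[OF h(2)]) (use g(2) Cons.prems in auto)
    hence "\<forall>t\<in>orthant. foldr partial_deriv (b # bs) f t = h t"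
      using partial_deriv_eqI[of b "foldr partial_deriv bs f" h] Cons.prems by simp
    thus ?case using h(1) by blast
  qed
  show ?thesis unfolding smooth_on_orthant_def
  proof (intro allI impI conjI ballI)
    fix bs assume bs: "set bs \<subseteq> (Basis :: 'a set)"
    obtain g where g: "g \<in> F" "\<forall>t\<in>orthant. foldr partial_deriv bs f t = g t"
      using rep[OF bs] by auto
    show "continuous_on orthant (foldr partial_deriv bs f)"
      using assms(2)[OF g(1)] g(2) by (simp cong: continuous_on_cong)
    fix b t :: 'a assume b: "b \<in> Basis" and t: "t \<in> orthant"
    obtain h where h: "has_partial_deriv b g h" using assms(3)[OF g(1) b] by auto
    have "has_partial_deriv b (foldr partial_deriv bs f) h"
      by (rule has_partial_deriv_cong[OF h b]) (use g(2) in auto)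
    from has_partial_derivD[OF this t]
    show "(\<lambda>s. foldr partial_deriv bs f (upd t b s)) differentiable (at (t \<bullet> b) within {0..})"
      using real_differentiable_def by blast
  qed
qed

lemma smooth_on_orthant_cong:
  assumes "smooth_on_orthant f" "\<And>t. t \<in> orthant \<Longrightarrow> g t = f t"
  shows "smooth_on_orthant g"
proof (rule smooth_on_orthant_coinduct[where F = "insert g {h. smooth_on_orthant h}"])
  fix h :: "'a \<Rightarrow> real" assume h: "h \<in> insert g {h. smooth_on_orthant h}"
  have "continuous_on orthant g"
    using smooth_on_orthant_continuous[OF assms(1)] assms(2) by (simp cong: continuous_on_cong)
  thus "continuous_on orthant h" using h smooth_on_orthant_continuous by auto
  fix b :: 'a assume b: "b \<in> Basis"
  have "has_partial_deriv b g (partial_deriv b f)"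
    by (rule has_partial_deriv_cong[OF smooth_on_orthant_has_partial_deriv[OF assms(1) b] b])
       (use assms(2) in auto)
  thus "\<exists>k\<in>insert g {h. smooth_on_orthant h}. has_partial_deriv b h k"
    using h smooth_on_orthant_partial_deriv[OF assms(1) b]
      smooth_on_orthant_partial_deriv[of h, OF _ b] smooth_on_orthant_has_partial_deriv[of h, OF _ b]
    by auto
qed simp

text \<open>
  The family of all products of two smooth functions is not a candidate for the coinduction, because
  the derivative of a product is a sum of products. The algebra generated by all smooth functions
  under the operations below is stable under partial derivatives, so all its members are smooth. This
  gives the closure of smoothness under each of the operations.
\<close>

inductive_set trig_algebra :: "('a::euclidean_space \<Rightarrow> real) set" where
  smooth: "smooth_on_orthant f \<Longrightarrow> f \<in> trig_algebra"
| const: "(\<lambda>t. c) \<in> trig_algebra"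
| add: "f \<in> trig_algebra \<Longrightarrow> g \<in> trig_algebra \<Longrightarrow> (\<lambda>t. f t + g t) \<in> trig_algebra"
| mult: "f \<in> trig_algebra \<Longrightarrow> g \<in> trig_algebra \<Longrightarrow> (\<lambda>t. f t * g t) \<in> trig_algebra"
| sin: "f \<in> trig_algebra \<Longrightarrow> (\<lambda>t. sin (f t)) \<in> trig_algebra"
| cos: "f \<in> trig_algebra \<Longrightarrow> (\<lambda>t. cos (f t)) \<in> trig_algebra"

lemma trig_algebra_smooth:
  assumes "f \<in> trig_algebra"
  shows "smooth_on_orthant f"
proof (rule smooth_on_orthant_coinduct[OF assms])
  show "continuous_on orthant g" if "g \<in> trig_algebra" for g :: "'a \<Rightarrow> real"
    using that by induction (auto intro!: continuous_intros intro: smooth_on_orthant_continuous)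
  show "\<exists>h\<in>trig_algebra. has_partial_deriv b g h"
    if "g \<in> trig_algebra" "b \<in> Basis" for g :: "'a \<Rightarrow> real" and b
    using that
  proof induction
    case (smooth f)
    thus ?case
      by (intro bexI[of _ "partial_deriv b f"] smooth_on_orthant_has_partial_deriv
          trig_algebra.smooth smooth_on_orthant_partial_deriv)
  next
    case (const c)
    show ?case by (rule bexI, rule has_partial_deriv_const, rule trig_algebra.const)
  next
    case (add f g)
    then obtain f' g' where *: "f' \<in> trig_algebra" "g' \<in> trig_algebra"
        "has_partial_deriv b f f'" "has_partial_deriv b g g'" by auto
    show ?case by (rule bexI, rule has_partial_deriv_add[OF *(3,4)], rule trig_algebra.add[OF *(1,2)])
  next
    case (mult f g)
    then obtain f' g' where *: "f' \<in> trig_algebra" "g' \<in> trig_algebra"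
        "has_partial_deriv b f f'" "has_partial_deriv b g g'" by auto
    show ?case
      by (rule bexI, rule has_partial_deriv_mult[OF *(3,4)])
         (rule trig_algebra.add; rule trig_algebra.mult; fact)
  next
    case (sin f)
    then obtain f' where *: "f' \<in> trig_algebra" "has_partial_deriv b f f'" by auto
    show ?case
      by (rule bexI, rule has_partial_deriv_sin[OF *(2)])
         (rule trig_algebra.mult[OF trig_algebra.cos[OF sin.hyps] *(1)])
  next
    case (cos f)
    then obtain f' where *: "f' \<in> trig_algebra" "has_partial_deriv b f f'" by auto
    have "(\<lambda>t. (- 1) * sin (f t) * f' t) \<in> trig_algebra"
      by (rule trig_algebra.mult[OF trig_algebra.mult[OF trig_algebra.const
            trig_algebra.sin[OF cos.hyps]] *(1)])
    thus ?case
      by (intro bexI[of _ "\<lambda>t. - sin (f t) * f' t"] has_partial_deriv_cos[OF *(2)]) simp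
  qed
qed

lemma smooth_on_orthant_const: "smooth_on_orthant (\<lambda>t. c)"
  by (rule trig_algebra_smooth[OF trig_algebra.const])

lemma smooth_on_orthant_mult:
  "smooth_on_orthant f \<Longrightarrow> smooth_on_orthant g \<Longrightarrow> smooth_on_orthant (\<lambda>t. f t * g t)"
  by (rule trig_algebra_smooth[OF trig_algebra.mult]) (rule trig_algebra.smooth, assumption)+

lemma smooth_on_orthant_diff:
  assumes "smooth_on_orthant f" "smooth_on_orthant g"
  shows "smooth_on_orthant (\<lambda>t. f t - g t)"
proof -
  have "(\<lambda>t. f t + (- 1) * g t) \<in> trig_algebra"
    by (rule trig_algebra.add[OF _ trig_algebra.mult[OF trig_algebra.const]])
       (rule trig_algebra.smooth, fact)+
  thus ?thesis using trig_algebra_smooth by fastforce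
qed

lemma smooth_on_orthant_sin: "smooth_on_orthant f \<Longrightarrow> smooth_on_orthant (\<lambda>t. sin (f t))"
  by (rule trig_algebra_smooth[OF trig_algebra.sin[OF trig_algebra.smooth]])

lemma smooth_on_orthant_cos: "smooth_on_orthant f \<Longrightarrow> smooth_on_orthant (\<lambda>t. cos (f t))"
  by (rule trig_algebra_smooth[OF trig_algebra.cos[OF trig_algebra.smooth]])

lemma smooth_on_orthant_prod:
  assumes "finite I" "\<And>i. i \<in> I \<Longrightarrow> smooth_on_orthant (f i)"
  shows "smooth_on_orthant (\<lambda>t. \<Prod>i\<in>I. f i t)"
  using assms by (induction I rule: finite_induct)
    (auto intro: smooth_on_orthant_const smooth_on_orthant_mult)

lemma has_partial_deriv_coord:
  assumes "has_partial_deriv 1 f f'" "0 \<le> c" "b \<in> Basis"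
  shows "has_partial_deriv b (\<lambda>t. f (c * (t \<bullet> b))) (\<lambda>t. c * f' (c * (t \<bullet> b)))"
  unfolding has_partial_deriv_def
proof
  fix t :: 'a assume t: "t \<in> orthant"
  have "c * (t \<bullet> b) \<in> orthant"
    using assms(2) orthant_inner[OF t assms(3)] by (simp add: orthant_real)
  from has_partial_derivD[OF assms(1) this]
  have "(f has_real_derivative f' (c * (t \<bullet> b))) (at (c * (t \<bullet> b)) within (\<lambda>s. c * s) ` {0..})"
    using assms(2) by (auto intro: has_field_derivative_subset)
  hence "(f \<circ> (\<lambda>s. c * s) has_real_derivative f' (c * (t \<bullet> b)) * c) (at (t \<bullet> b) within {0..})"
    by (rule DERIV_image_chain) (auto intro!: derivative_eq_intros)
  thus "((\<lambda>s. f (c * (upd t b s \<bullet> b))) has_real_derivative c * f' (c * (t \<bullet> b)))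
          (at (t \<bullet> b) within {0..})"
    using assms(3) by (simp add: inner_upd o_def mult_ac)
qed

lemma has_partial_deriv_other_coord:
  assumes "b \<in> Basis" "b' \<in> Basis" "b' \<noteq> b"
  shows "has_partial_deriv b' (\<lambda>t. f (c * (t \<bullet> b))) (\<lambda>t. 0)"
  unfolding has_partial_deriv_def using assms by (simp add: inner_upd inner_add_left inner_Basis)

text \<open>
  The family for the coinduction consists of all functions of the single coordinate \<open>c * (t \<bullet> b)\<close>:
  the derivative in direction \<open>b\<close> composes \<open>c f'\<close> with this coordinate, and the derivatives in the
  other directions vanish.
\<close>

lemma smooth_on_orthant_coord:
  assumes "smooth_on_orthant (f :: real \<Rightarrow> real)" "0 \<le> c" "b \<in> Basis"
  shows "smooth_on_orthant (\<lambda>t. f (c * (t \<bullet> b)))"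
proof (rule smooth_on_orthant_coinduct
    [where F = "{\<lambda>t. f (c * (t \<bullet> b)) | f. smooth_on_orthant f}"])
  fix g :: "'a \<Rightarrow> real" assume "g \<in> {\<lambda>t. f (c * (t \<bullet> b)) | f. smooth_on_orthant f}"
  then obtain f where f: "smooth_on_orthant f" and g: "g = (\<lambda>t. f (c * (t \<bullet> b)))" by auto
  show "continuous_on orthant g" unfolding g
    by (rule continuous_on_compose2[OF smooth_on_orthant_continuous[OF f]])
       (use assms(2,3) orthant_inner in
         \<open>auto intro!: continuous_intros mult_nonneg_nonneg simp: orthant_real\<close>)
  fix b' :: 'a assume b': "b' \<in> Basis"
  show "\<exists>h\<in>{\<lambda>t. f (c * (t \<bullet> b)) | f. smooth_on_orthant f}. has_partial_deriv b' g h"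
  proof (cases "b' = b")
    case True
    have "has_partial_deriv 1 f (partial_deriv 1 f)"
      by (rule smooth_on_orthant_has_partial_deriv[OF f]) simp
    from has_partial_deriv_coord[OF this assms(2,3)]
    have "has_partial_deriv b' g (\<lambda>t. c * partial_deriv 1 f (c * (t \<bullet> b)))"
      using True g by simp
    moreover have "smooth_on_orthant (\<lambda>x. c * partial_deriv 1 f x)"
      by (intro smooth_on_orthant_mult smooth_on_orthant_const smooth_on_orthant_partial_deriv f) simp
    ultimately show ?thesis
      by (intro bexI[of _ "\<lambda>t. c * partial_deriv 1 f (c * (t \<bullet> b))"])
         (auto intro!: exI[of _ "\<lambda>x. c * partial_deriv 1 f x"])
  next
    case False
    have "has_partial_deriv b' g (\<lambda>t. 0)"
      unfolding g by (rule has_partial_deriv_other_coord) (use False b' assms(3) in auto)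
    moreover have "\<exists>f. (\<lambda>t. 0) = (\<lambda>t::'a. f (c * (t \<bullet> b))) \<and> smooth_on_orthant f"
      by (rule exI[of _ "\<lambda>x. 0"]) (simp add: smooth_on_orthant_const)
    ultimately show ?thesis by (intro bexI[of _ "\<lambda>t. 0"]) auto
  qed
qed (use assms(1) in auto)

section \<open>Taylor coefficients in a coordinate direction\<close>

text \<open>
  The normalisation by \<open>1/k!\<close> matches the definition of \<open>smooth_class\<close> and removes the binomial
  coefficients from the Leibniz rule, which becomes the Cauchy product of coefficient sequences.
\<close>

definition taylor_coeff :: "'a::euclidean_space \<Rightarrow> ('a \<Rightarrow> real) \<Rightarrow> nat \<Rightarrow> 'a \<Rightarrow> real" where
  "taylor_coeff b f k t = (partial_deriv b ^^ k) f t / fact k"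

lemma taylor_coeff_0 [simp]: "taylor_coeff b f 0 = f"
  by (simp add: taylor_coeff_def fun_eq_iff)

lemma has_partial_deriv_taylor_coeff:
  assumes "smooth_on_orthant f" "b \<in> Basis"
  shows "has_partial_deriv b (taylor_coeff b f k) (\<lambda>t. real (Suc k) * taylor_coeff b f (Suc k) t)"
proof -
  have "smooth_on_orthant ((partial_deriv b ^^ k) f)"
    by (induction k) (use assms in \<open>auto intro: smooth_on_orthant_partial_deriv\<close>)
  from smooth_on_orthant_has_partial_deriv[OF this assms(2)]
  have "has_partial_deriv b ((partial_deriv b ^^ k) f) ((partial_deriv b ^^ Suc k) f)" by simp
  from has_partial_deriv_mult[OF has_partial_deriv_const[of b "1 / fact k"] this]
  have *: "has_partial_deriv b (\<lambda>t. 1 / fact k * (partial_deriv b ^^ k) f t)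
          (\<lambda>t. 1 / fact k * (partial_deriv b ^^ Suc k) f t)" by simp
  show ?thesis
    by (rule has_partial_deriv_cong[OF * assms(2)]) (simp_all add: taylor_coeff_def del: of_nat_Suc)
qed

text \<open>
  Taylor coefficients are determined by the recursion \<open>D g_k = (k + 1) g_(k + 1)\<close>. Closed formulas
  are therefore verified by differentiating them once.
\<close>

lemma taylor_coeff_eqI:
  assumes "b \<in> Basis" "\<And>t. t \<in> orthant \<Longrightarrow> f t = g 0 t"
    and "\<And>k. has_partial_deriv b (g k) (\<lambda>t. real (Suc k) * g (Suc k) t)"
    and "t \<in> orthant"
  shows "taylor_coeff b f k t = g k t"
proof -
  have "(partial_deriv b ^^ k) f t = fact k * g k t" using assms(4)
  proof (induction k arbitrary: t)
    case 0
    thus ?case using assms(2) by simp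
  next
    case (Suc k)
    from has_partial_deriv_mult[OF has_partial_deriv_const[of b "fact k"] assms(3)]
    have *: "has_partial_deriv b (\<lambda>t. fact k * g k t) (\<lambda>t. fact (Suc k) * g (Suc k) t)"
      by (simp add: algebra_simps)
    have "has_partial_deriv b ((partial_deriv b ^^ k) f) (\<lambda>t. fact (Suc k) * g (Suc k) t)"
      by (rule has_partial_deriv_cong[OF * assms(1)]) (use Suc.IH in auto)
    from partial_deriv_eqI[OF this Suc.prems assms(1)] show ?case by simp
  qed
  thus ?thesis by (simp add: taylor_coeff_def)
qed

lemma taylor_coeff_cong:
  assumes "smooth_on_orthant f" "b \<in> Basis" "\<And>t. t \<in> orthant \<Longrightarrow> g t = f t" "t \<in> orthant"
  shows "taylor_coeff b g k t = taylor_coeff b f k t"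
  by (rule taylor_coeff_eqI)
     (use assms has_partial_deriv_taylor_coeff in \<open>simp_all del: of_nat_Suc\<close>)

lemma taylor_coeff_diff:
  assumes "smooth_on_orthant f" "smooth_on_orthant g" "b \<in> Basis" "t \<in> orthant"
  shows "taylor_coeff b (\<lambda>t. f t - g t) k t = taylor_coeff b f k t - taylor_coeff b g k t"
proof (rule taylor_coeff_eqI[where g = "\<lambda>k t. taylor_coeff b f k t - taylor_coeff b g k t"])
  fix k
  from has_partial_deriv_diff[OF has_partial_deriv_taylor_coeff[OF assms(1,3)]
      has_partial_deriv_taylor_coeff[OF assms(2,3)]]
  show "has_partial_deriv b (\<lambda>t. taylor_coeff b f k t - taylor_coeff b g k t)
      (\<lambda>t. real (Suc k) * (taylor_coeff b f (Suc k) t - taylor_coeff b g (Suc k) t))"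
    by (simp add: right_diff_distrib)
qed (use assms in auto)

lemma taylor_coeff_cmult:
  assumes "smooth_on_orthant f" "b \<in> Basis" "t \<in> orthant"
  shows "taylor_coeff b (\<lambda>t. r * f t) k t = r * taylor_coeff b f k t"
proof (rule taylor_coeff_eqI[where g = "\<lambda>k t. r * taylor_coeff b f k t"])
  fix k
  from has_partial_deriv_mult[OF has_partial_deriv_const[of b r]
      has_partial_deriv_taylor_coeff[OF assms(1,2)]]
  show "has_partial_deriv b (\<lambda>t. r * taylor_coeff b f k t)
      (\<lambda>t. real (Suc k) * (r * taylor_coeff b f (Suc k) t))"
    by (simp add: mult_ac)
qed (use assms in auto)

text \<open>
  Differentiating the Cauchy product \<open>\<Sum>i\<le>k. f_i g_(k-i)\<close> gives, after a shift of one of the two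
  sums, \<open>\<Sum>i\<le>k+1. (i + (k+1-i)) f_i g_(k+1-i)\<close>.
\<close>

lemma taylor_coeff_mult:
  assumes "smooth_on_orthant f" "smooth_on_orthant g" "b \<in> Basis" "t \<in> orthant"
  shows "taylor_coeff b (\<lambda>t. f t * g t) k t =
           (\<Sum>i\<le>k. taylor_coeff b f i t * taylor_coeff b g (k - i) t)"
proof (rule taylor_coeff_eqI[where
      g = "\<lambda>k t. \<Sum>i\<le>k. taylor_coeff b f i t * taylor_coeff b g (k - i) t"])
  fix k
  let ?f = "taylor_coeff b f" and ?g = "taylor_coeff b g"
  have D: "has_partial_deriv b (\<lambda>t. \<Sum>i\<le>k. ?f i t * ?g (k - i) t)
      (\<lambda>t. \<Sum>i\<le>k. real (Suc i) * ?f (Suc i) t * ?g (k - i) t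
                 + ?f i t * (real (Suc (k - i)) * ?g (Suc (k - i)) t))"
    by (intro has_partial_deriv_sum has_partial_deriv_mult
        has_partial_deriv_taylor_coeff[OF assms(1,3)] has_partial_deriv_taylor_coeff[OF assms(2,3)])
  show "has_partial_deriv b (\<lambda>t. \<Sum>i\<le>k. ?f i t * ?g (k - i) t)
      (\<lambda>t. real (Suc k) * (\<Sum>i\<le>Suc k. ?f i t * ?g (Suc k - i) t))"
  proof (rule has_partial_deriv_cong[OF D assms(3) refl])
    fix t :: 'a
    \<comment> \<open>The factor \<open>k + 1\<close> is split as \<open>i + (k + 1 - i)\<close>, one part for each term of the product rule.\<close>
    let ?h = "\<lambda>i. ?f i t * ?g (Suc k - i) t"
    have "real (Suc k) * (\<Sum>i\<le>Suc k. ?h i)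
        = (\<Sum>i\<le>Suc k. real i * ?h i + real (Suc k - i) * ?h i)"
      unfolding sum_distrib_left
      by (rule sum.cong) (auto simp: of_nat_diff algebra_simps)
    also have "\<dots> = (\<Sum>i\<le>Suc k. real i * ?h i) + (\<Sum>i\<le>Suc k. real (Suc k - i) * ?h i)"
      by (rule sum.distrib)
    also have "(\<Sum>i\<le>Suc k. real i * ?h i) = (\<Sum>i\<le>k. real (Suc i) * ?f (Suc i) t * ?g (k - i) t)"
      by (subst sum.atMost_Suc_shift) (simp add: mult_ac)
    also have "(\<Sum>i\<le>Suc k. real (Suc k - i) * ?h i)
        = (\<Sum>i\<le>k. ?f i t * (real (Suc (k - i)) * ?g (Suc (k - i)) t))"
      by (simp, intro sum.cong) (auto simp: Suc_diff_le mult_ac)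
    finally show "real (Suc k) * (\<Sum>i\<le>Suc k. ?h i) =
        (\<Sum>i\<le>k. real (Suc i) * ?f (Suc i) t * ?g (k - i) t
                 + ?f i t * (real (Suc (k - i)) * ?g (Suc (k - i)) t))"
      by (simp only: sum.distrib)
  qed
qed (use assms in auto)

lemma taylor_coeff_partial_deriv:
  "taylor_coeff b (partial_deriv b f) k t = real (Suc k) * taylor_coeff b f (Suc k) t"
  by (simp add: taylor_coeff_def funpow_swap1 del: of_nat_Suc)

lemma taylor_coeff_coord_mult:
  fixes f :: "real \<Rightarrow> real" and Q :: "'a::euclidean_space \<Rightarrow> real"
  assumes "smooth_on_orthant f" "has_partial_deriv b Q (\<lambda>t. 0)"
    and "0 \<le> c" "b \<in> Basis" "t \<in> orthant"
  shows "taylor_coeff b (\<lambda>t. f (c * (t \<bullet> b)) * Q t) k t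
           = c ^ k * taylor_coeff 1 f k (c * (t \<bullet> b)) * Q t"
proof (rule taylor_coeff_eqI[where
      g = "\<lambda>k t. c ^ k * taylor_coeff 1 f k (c * (t \<bullet> b)) * Q t"])
  fix k
  have "has_partial_deriv 1 (taylor_coeff 1 f k) (\<lambda>t. real (Suc k) * taylor_coeff 1 f (Suc k) t)"
    by (rule has_partial_deriv_taylor_coeff[OF assms(1)]) simp
  from has_partial_deriv_mult[OF has_partial_deriv_mult[OF has_partial_deriv_const[of b "c ^ k"]
        has_partial_deriv_coord[OF this assms(3,4)]] assms(2)]
  show "has_partial_deriv b (\<lambda>t. c ^ k * taylor_coeff 1 f k (c * (t \<bullet> b)) * Q t)
     (\<lambda>t. real (Suc k) * (c ^ Suc k * taylor_coeff 1 f (Suc k) (c * (t \<bullet> b)) * Q t))"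
    by (simp add: mult_ac)
qed (use assms in auto)

lemma taylor_coeff_deriv_eqI:
  assumes "smooth_on_orthant f" "b \<in> Basis" "smooth_on_orthant g" "has_partial_deriv b f g" "t \<in> orthant"
  shows "real (Suc k) * taylor_coeff b f (Suc k) t = taylor_coeff b g k t"
  unfolding taylor_coeff_partial_deriv[symmetric]
  by (rule taylor_coeff_cong) (use assms partial_deriv_eqI in auto)

section \<open>Taylor coefficients of a sine\<close>

text \<open>
  This replaces the formula of Faa di Bruno. Since \<open>sin \<circ> h\<close> has derivative \<open>(cos \<circ> h) h'\<close> and
  \<open>cos \<circ> h\<close> has derivative \<open>- (sin \<circ> h) h'\<close>, the coefficients of the two functions satisfy, up to
  sign, the coupled recursion
  \<open>(n + 1) S_(n+1) = \<Sum>i\<le>n. C_i (n + 1 - i) h_(n+1-i)\<close>, and both are estimated by one strong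
  induction. All values of \<open>L\<close> that occur in step \<open>n + 1\<close> are at most \<open>L n\<close>, and the
  exponents of \<open>r L n\<close> add up to \<open>n + 1\<close>. What remains is a geometric sum:
  \<open>\<Sum>i\<le>n. c (1 + c)^i = (1 + c)^(n+1) - 1\<close>, which is why the constant \<open>1 + c\<close> reproduces itself.
\<close>

lemma taylor_coeff_sin_cos_bound:
  fixes h :: "'a::euclidean_space \<Rightarrow> real" and L :: "real \<Rightarrow> real"
  assumes h: "smooth_on_orthant h" and b: "b \<in> Basis" and t: "t \<in> orthant"
    and L: "mono_on {0..} L" "\<And>x. 0 \<le> x \<Longrightarrow> 0 \<le> L x"
    and c: "0 \<le> c" and r: "0 \<le> r"
    and bound: "\<And>k. 1 \<le> k \<Longrightarrow> \<bar>taylor_coeff b h k t\<bar> \<le> c * (r * L (real k - 1)) ^ k"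
  shows "\<bar>taylor_coeff b (\<lambda>t. sin (h t)) k t\<bar> \<le> ((1 + c) * r * L (real k - 1)) ^ k \<and>
         \<bar>taylor_coeff b (\<lambda>t. cos (h t)) k t\<bar> \<le> ((1 + c) * r * L (real k - 1)) ^ k"
proof (induction k rule: less_induct)
  case (less k)
  show ?case
  proof (cases k)
    case 0
    thus ?thesis by simp
  next
    case (Suc n)
    \<comment> \<open>The step is common to the pairs \<open>(f, g) = (sin \<circ> h, cos \<circ> h)\<close> and \<open>(cos \<circ> h, - sin \<circ> h)\<close>.\<close>
    have step: "\<bar>taylor_coeff b f (Suc n) t\<bar> \<le> ((1 + c) * r * L (real n)) ^ Suc n"
      if f: "smooth_on_orthant f" and g: "smooth_on_orthant g"
        and D: "has_partial_deriv b f (\<lambda>t. g t * partial_deriv b h t)"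
        and IH: "\<And>i. i \<le> n \<Longrightarrow> \<bar>taylor_coeff b g i t\<bar> \<le> ((1 + c) * r * L (real i - 1)) ^ i"
      for f g
    proof -
      have h': "smooth_on_orthant (partial_deriv b h)"
        by (rule smooth_on_orthant_partial_deriv[OF h b])
      have Ln: "0 \<le> L (real n)" using L(2) by simp
      have "real (Suc n) * taylor_coeff b f (Suc n) t
          = taylor_coeff b (\<lambda>t. g t * partial_deriv b h t) n t"
        by (rule taylor_coeff_deriv_eqI[OF f b smooth_on_orthant_mult[OF g h'] D t])
      also have "\<dots> = (\<Sum>i\<le>n. taylor_coeff b g i t *
                          (real (Suc (n - i)) * taylor_coeff b h (Suc (n - i)) t))"
        by (simp only: taylor_coeff_mult[OF g h' b t] taylor_coeff_partial_deriv)
      finally have "real (Suc n) * \<bar>taylor_coeff b f (Suc n) t\<bar> =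
          \<bar>\<Sum>i\<le>n. taylor_coeff b g i t *
                          (real (Suc (n - i)) * taylor_coeff b h (Suc (n - i)) t)\<bar>"
        by (metis abs_mult abs_of_nat)
      also have "\<dots> \<le> (\<Sum>i\<le>n. \<bar>taylor_coeff b g i t *
                          (real (Suc (n - i)) * taylor_coeff b h (Suc (n - i)) t)\<bar>)"
        by (rule sum_abs)
      also have "\<dots> \<le> (\<Sum>i\<le>n. real (Suc n) * (c * (1 + c) ^ i * (r * L (real n)) ^ Suc n))"
      proof (rule sum_mono)
        fix i assume "i \<in> {..n}"
        hence i: "i \<le> n" by simp
        have "((1 + c) * r * L (real i - 1)) ^ i \<le> ((1 + c) * r * L (real n)) ^ i"
        \<comment> \<open>For \<open>i = 0\<close> the argument \<open>-1\<close> lies outside the domain of monotonicity, but the power is 1.\<close>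
        proof (cases "i = 0")
          case False
          hence "L (real i - 1) \<le> L (real n)" "0 \<le> L (real i - 1)"
            using i by (auto intro!: mono_onD[OF L(1)] L(2))
          thus ?thesis using c r by (intro power_mono mult_left_mono) auto
        qed simp
        hence 1: "\<bar>taylor_coeff b g i t\<bar> \<le> ((1 + c) * r * L (real n)) ^ i"
          using IH[OF i] by linarith
        have "\<bar>taylor_coeff b h (Suc (n - i)) t\<bar> \<le> c * (r * L (real (n - i))) ^ Suc (n - i)"
          using bound[of "Suc (n - i)"] by simp
        also have "\<dots> \<le> c * (r * L (real n)) ^ Suc (n - i)"
          by (intro mult_left_mono power_mono mono_onD[OF L(1)]) (use c r L(2) in auto)
        finally have 2: "real (Suc (n - i)) * \<bar>taylor_coeff b h (Suc (n - i)) t\<bar>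
            \<le> real (Suc n) * (c * (r * L (real n)) ^ Suc (n - i))"
          by (intro mult_mono) auto
        have "\<bar>taylor_coeff b g i t * (real (Suc (n - i)) * taylor_coeff b h (Suc (n - i)) t)\<bar>
            = \<bar>taylor_coeff b g i t\<bar> * (real (Suc (n - i)) * \<bar>taylor_coeff b h (Suc (n - i)) t\<bar>)"
          by (simp only: abs_mult abs_of_nat)
        also have "\<dots> \<le> ((1 + c) * r * L (real n)) ^ i *
            (real (Suc n) * (c * (r * L (real n)) ^ Suc (n - i)))"
          by (intro mult_mono 1 2) (use c r Ln in auto)
        also have "\<dots> = real (Suc n) * (c * (1 + c) ^ i * ((r * L (real n)) ^ i * (r * L (real n)) ^ Suc (n - i)))"
          by (simp only: power_mult_distrib mult_ac)
        also have "(r * L (real n)) ^ i * (r * L (real n)) ^ Suc (n - i) = (r * L (real n)) ^ Suc n"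
          using i by (simp only: power_add[symmetric]) simp
        finally show "\<bar>taylor_coeff b g i t * (real (Suc (n - i)) * taylor_coeff b h (Suc (n - i)) t)\<bar>
            \<le> real (Suc n) * (c * (1 + c) ^ i * (r * L (real n)) ^ Suc n)" .
      qed
      also have "\<dots> = real (Suc n) * ((r * L (real n)) ^ Suc n * (c * (\<Sum>i\<le>n. (1 + c) ^ i)))"
        by (simp only: sum_distrib_left mult_ac)
      also have "c * (\<Sum>i\<le>n. (1 + c) ^ i) = (1 + c) ^ Suc n - 1"
        using power_diff_1_eq[of "1 + c" "Suc n"] by (simp add: lessThan_Suc_atMost)
      also have "real (Suc n) * ((r * L (real n)) ^ Suc n * ((1 + c) ^ Suc n - 1))
          \<le> real (Suc n) * ((r * L (real n)) ^ Suc n * (1 + c) ^ Suc n)"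
        by (intro mult_left_mono) (use r Ln in auto)
      also have "(r * L (real n)) ^ Suc n * (1 + c) ^ Suc n = ((1 + c) * r * L (real n)) ^ Suc n"
        by (simp only: power_mult_distrib mult_ac)
      finally show ?thesis by (simp only: mult_le_cancel_left_pos of_nat_0_less_iff zero_less_Suc)
    qed
    note h' = smooth_on_orthant_has_partial_deriv[OF h b]
    have s: "smooth_on_orthant (\<lambda>t. sin (h t))" "smooth_on_orthant (\<lambda>t. cos (h t))"
      by (intro smooth_on_orthant_sin smooth_on_orthant_cos h)+
    have ms: "smooth_on_orthant (\<lambda>t. - sin (h t))"
      using smooth_on_orthant_diff[OF smooth_on_orthant_const s(1), of 0] by simp
    have neg: "taylor_coeff b (\<lambda>t. - sin (h t)) i t = - taylor_coeff b (\<lambda>t. sin (h t)) i t" for i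
      using taylor_coeff_cmult[OF s(1) b t, of "- 1" i] by simp
    have "\<bar>taylor_coeff b (\<lambda>t. sin (h t)) (Suc n) t\<bar> \<le> ((1 + c) * r * L (real n)) ^ Suc n"
      by (rule step[OF s has_partial_deriv_sin[OF h']]) (use less Suc in auto)
    moreover have "\<bar>taylor_coeff b (\<lambda>t. cos (h t)) (Suc n) t\<bar> \<le> ((1 + c) * r * L (real n)) ^ Suc n"
      by (rule step[OF s(2) ms has_partial_deriv_cos[OF h']]) (use less Suc neg in auto)
    ultimately show ?thesis using Suc by simp
  qed
qed

section \<open>Smoothness classes and cutoff functions of second kind\<close>

lemma smooth_class_iff:
  "f \<in> smooth_class L \<gamma> \<beta> \<longleftrightarrow>
     smooth_on_orthant f \<and> (\<forall>t\<in>orthant. \<bar>f t\<bar> \<le> \<gamma>) \<and>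
     (\<forall>k\<ge>1. \<forall>b\<in>Basis. \<forall>t\<in>orthant. \<bar>taylor_coeff b f k t\<bar> \<le> \<gamma> * (\<beta> * L (real k - 1)) ^ k)"
proof -
  have sup: "sup_norm g \<le> ereal x \<longleftrightarrow> (\<forall>t\<in>orthant. \<bar>g t\<bar> \<le> x)" for g :: "'a \<Rightarrow> real" and x
    by (simp add: sup_norm_def SUP_le_iff)
  have "ereal (1 / fact k) * sup_norm ((partial_deriv b ^^ k) f) \<le> ereal x \<longleftrightarrow>
      (\<forall>t\<in>orthant. \<bar>taylor_coeff b f k t\<bar> \<le> x)" for k b x
  proof -
    have "ereal (1 / fact k) * sup_norm ((partial_deriv b ^^ k) f) \<le> ereal x \<longleftrightarrow>
        sup_norm ((partial_deriv b ^^ k) f) \<le> ereal (x * fact k)"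
      using ereal_le_divide_pos[of "ereal (1 / fact k)" "sup_norm ((partial_deriv b ^^ k) f)" "ereal x"]
      by simp
    thus ?thesis by (simp add: sup taylor_coeff_def field_simps)
  qed
  thus ?thesis by (simp add: smooth_class_def sup)
qed

lemma smooth_class_cong:
  assumes "f \<in> smooth_class L \<gamma> \<beta>" "\<And>t. t \<in> orthant \<Longrightarrow> g t = f t"
  shows "g \<in> smooth_class L \<gamma> \<beta>"
  using assms smooth_on_orthant_cong[of f g] taylor_coeff_cong[of f _ g]
  by (auto simp: smooth_class_iff)

text \<open>
  The derivative within the half-line restricts to a derivative within the plateau, where it is unique
  at every point that is not isolated. This covers the end points of the plateau, where the
  function is constant on one side only.
\<close>

lemma taylor_coeff_zero_on_plateau:
  fixes a :: "real \<Rightarrow> real"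
  assumes a: "smooth_on_orthant a" and I: "I \<subseteq> {0..}" "\<And>x. x \<in> I \<Longrightarrow> at x within I \<noteq> bot"
    and const: "\<And>x. x \<in> I \<Longrightarrow> a x = v" and "1 \<le> k" "x \<in> I"
  shows "taylor_coeff 1 a k x = 0"
proof -
  have step: "taylor_coeff 1 a (Suc n) x = 0"
    if "x \<in> I" "\<And>y. y \<in> I \<Longrightarrow> taylor_coeff 1 a n y = w" for n w x
  proof -
    have "has_partial_deriv 1 (taylor_coeff 1 a n) (\<lambda>t. real (Suc n) * taylor_coeff 1 a (Suc n) t)"
      by (rule has_partial_deriv_taylor_coeff[OF a]) simp
    from has_partial_derivD[OF this, of x]
    have "(taylor_coeff 1 a n has_real_derivative real (Suc n) * taylor_coeff 1 a (Suc n) x)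
            (at x within {0..})"
      using that(1) I(1) by (auto simp: orthant_real)
    hence "(taylor_coeff 1 a n has_real_derivative real (Suc n) * taylor_coeff 1 a (Suc n) x)
            (at x within I)"
      by (rule has_field_derivative_subset[OF _ I(1)])
    hence "((\<lambda>y. w) has_real_derivative real (Suc n) * taylor_coeff 1 a (Suc n) x) (at x within I)"
      by (rule has_field_derivative_transform_within[where d = 1]) (use that in auto)
    from has_field_derivative_unique[OF this _ I(2)[OF that(1)], of 0]
    show ?thesis by simp
  qed
  have "\<exists>w. \<forall>y\<in>I. taylor_coeff 1 a n y = w" for n
    by (induction n) (use const step in auto)
  thus ?thesis using step assms(5,6) by (cases k) (auto, blast)
qed

lemma infnorm_le_iff: "infnorm t \<le> r \<longleftrightarrow> (\<forall>b\<in>Basis. \<bar>t \<bullet> b\<bar> \<le> r)"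
  by (simp add: infnorm_Max)

lemma infnorm_attained:
  obtains b where "b \<in> Basis" "\<bar>t \<bullet> b\<bar> = infnorm t"
proof -
  have "infnorm t \<in> (\<lambda>b. \<bar>t \<bullet> b\<bar>) ` Basis"
    unfolding infnorm_Max by (rule Max_in) auto
  thus ?thesis using that by auto
qed

lemma infnorm_le_of_unit_ball_1:
  assumes "t \<in> unit_ball_1"
  shows "infnorm t \<le> 1"
  unfolding infnorm_le_iff
proof
  fix b :: 'a assume "b \<in> Basis"
  hence "\<bar>t \<bullet> b\<bar> \<le> (\<Sum>b\<in>Basis. \<bar>t \<bullet> b\<bar>)" by (intro member_le_sum) auto
  thus "\<bar>t \<bullet> b\<bar> \<le> 1" using assms by (simp add: unit_ball_1_def)
qed

text \<open>
  On the orthant the box \<open>[0,2]\<^sup>d\<close> is the set \<open>infnorm t \<le> 2\<close>, so the support condition says that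
  the function vanishes for larger norms.
\<close>

lemma second_kindI:
  assumes "smooth_on_orthant A"
    and "\<And>t. t \<in> orthant \<Longrightarrow> infnorm t > 2 \<Longrightarrow> A t = 0"
    and "\<And>t b. t \<in> orthant \<Longrightarrow> b \<in> Basis \<Longrightarrow> t \<bullet> b \<le> 1/2 * infnorm t \<Longrightarrow> A t = A (coord_proj b t)"
  shows "second_kind A"
proof -
  have "support_on orthant A \<subseteq> cbox 0 (2 *\<^sub>R One)"
  proof
    fix t assume t: "t \<in> support_on orthant A"
    hence "infnorm t \<le> 2" using assms(2)[of t] by (auto simp: support_on_def not_le[symmetric])
    thus "t \<in> cbox 0 (2 *\<^sub>R One)"
      using t by (auto simp: mem_box support_on_def orthant_def infnorm_le_iff)
  qed
  hence "closure (support_on orthant A) \<subseteq> cbox 0 (2 *\<^sub>R One)"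
    by (intro closure_minimal closed_cbox)
  thus ?thesis using assms(1,3) by (simp add: second_kind_def)
qed

lemma coord_proj_in_orthant: "t \<in> orthant \<Longrightarrow> b \<in> Basis \<Longrightarrow> coord_proj b t \<in> orthant"
  using upd_in_orthant[of t b 0] by (simp add: coord_proj_def)

lemma inner_coord_proj:
  "b \<in> Basis \<Longrightarrow> b' \<in> Basis \<Longrightarrow> coord_proj b t \<bullet> b' = (if b' = b then 0 else t \<bullet> b')"
  using inner_upd[of b b' t 0] by (simp add: coord_proj_def)

lemma second_kind_cong:
  assumes "\<And>t. t \<in> orthant \<Longrightarrow> f t = g t" "second_kind g"
  shows "second_kind f"
proof -
  have "support_on orthant f = support_on orthant g"
    using assms(1) by (auto simp: support_on_def)
  moreover have "smooth_on_orthant f"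
    using assms smooth_on_orthant_cong by (auto simp: second_kind_def)
  ultimately show ?thesis
    using assms by (simp add: second_kind_def coord_proj_in_orthant)
qed

lemma second_kind_a_cong:
  assumes "\<And>t. t \<in> orthant \<Longrightarrow> f t = g t" "second_kind_a g"
  shows "second_kind_a f"
  using assms second_kind_cong[of f g] by (simp add: second_kind_a_def unit_ball_1_def)

lemma second_kind_b_cong:
  assumes "\<And>t. t \<in> orthant \<Longrightarrow> f t = g t" "second_kind_b g"
  shows "second_kind_b f"
  using assms second_kind_cong[of f g]
  by (auto simp: second_kind_b_def unit_ball_1_def orthant_scaleR)

lemma scaleR_image_iff:
  fixes t :: "'a::real_vector"
  assumes "c \<noteq> 0"
  shows "t \<in> (*\<^sub>R) c ` S \<longleftrightarrow> (1 / c) *\<^sub>R t \<in> S"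
proof
  assume "(1 / c) *\<^sub>R t \<in> S"
  hence "c *\<^sub>R ((1 / c) *\<^sub>R t) \<in> (*\<^sub>R) c ` S" by blast
  thus "t \<in> (*\<^sub>R) c ` S" using assms by simp
qed (use assms in auto)

section \<open>Tensor products of a univariate cutoff function\<close>

text \<open>
  The dilation by \<open>c\<close> is part of the definition because the three functions of the theorem are built
  from the values \<open>c = 1\<close> and \<open>c = 2\<close>, and the partition of unity from all \<open>c = 2 / 2^j\<close>.
\<close>

definition scaled_tensor :: "(real \<Rightarrow> real) \<Rightarrow> real \<Rightarrow> 'a::euclidean_space \<Rightarrow> real" where
  "scaled_tensor a c t = (\<Prod>b\<in>Basis. a (c * (t \<bullet> b)))"

lemma scaled_tensor_scaleR: "scaled_tensor a c (r *\<^sub>R t) = scaled_tensor a (c * r) t"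
  by (simp add: scaled_tensor_def mult_ac)

locale univariate_cutoff =
  fixes a :: "real \<Rightarrow> real"
  assumes admissible: "admissible_univariate_a a"
    and range: "\<And>s. 0 \<le> s \<Longrightarrow> 0 \<le> a s \<and> a s \<le> 1"
begin

lemma smooth: "smooth_on_orthant a"
  using admissible by (simp add: admissible_univariate_a_def admissible_univariate_def)

lemma eq_1: "0 \<le> s \<Longrightarrow> s \<le> 1 \<Longrightarrow> a s = 1"
  using admissible by (simp add: admissible_univariate_a_def)

text \<open>
  The support condition alone leaves the value at the point 2 open; it is 0 by continuity.
\<close>

lemma eq_0:
  assumes "2 \<le> s"
  shows "a s = 0"
proof -
  have outside: "a s = 0" if "s > 2" for s
  proof (rule ccontr)
    assume "a s \<noteq> 0"
    hence "s \<in> closure (support_on {0..} a)"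
      using that by (intro closure_subset[THEN subsetD]) (auto simp: support_on_def)
    thus False
      using admissible that by (auto simp: admissible_univariate_a_def admissible_univariate_def)
  qed
  have "continuous_on {2..} a"
    using smooth_on_orthant_continuous[OF smooth] by (rule continuous_on_subset) (auto simp: orthant_real)
  hence "(a \<longlongrightarrow> a 2) (at_right 2)"
    by (auto simp: continuous_on_def intro: tendsto_within_subset)
  moreover have "(a \<longlongrightarrow> 0) (at_right 2)"
    by (rule tendsto_eventually) (auto simp: eventually_at_right_less outside eventually_at_filter)
  ultimately have "a 2 = 0" by (intro tendsto_unique[of "at_right 2"]) auto
  thus ?thesis using outside[of s] assms by (cases "s = 2") auto
qed

lemma taylor_coeff_eq_0:
  assumes "1 \<le> k" "0 \<le> s" "s \<le> 1 \<or> 2 \<le> s"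
  shows "taylor_coeff 1 a k s = 0"
proof (cases "s \<le> 1")
  case True
  show ?thesis
    by (rule taylor_coeff_zero_on_plateau[OF smooth, of "{0..1}" 1])
       (use assms True eq_1 in \<open>auto simp: trivial_limit_within\<close>)
next
  case False
  have "at x within {2..} \<noteq> bot" if "2 \<le> x" for x :: real
  proof -
    have "x islimpt {x..x + 1}" "{x..x + 1} \<subseteq> {2..}" using that by (auto simp: islimpt_Icc)
    hence "x islimpt {2..}" by (rule islimpt_subset)
    thus ?thesis by (simp add: trivial_limit_within)
  qed
  thus ?thesis
    by (intro taylor_coeff_zero_on_plateau[OF smooth, of "{2..}" 0])
       (use assms False eq_0 in auto)
qed

lemma scaled_tensor_smooth: "0 \<le> c \<Longrightarrow> smooth_on_orthant (scaled_tensor a c)"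
  unfolding scaled_tensor_def
  by (intro smooth_on_orthant_prod smooth_on_orthant_coord[OF smooth]) auto

lemma factor_range:
  assumes "t \<in> orthant" "0 \<le> c" "b \<in> Basis"
  shows "0 \<le> a (c * (t \<bullet> b)) \<and> a (c * (t \<bullet> b)) \<le> 1"
  using assms orthant_inner by (intro range mult_nonneg_nonneg)

lemma scaled_tensor_range:
  assumes "t \<in> orthant" "0 \<le> c"
  shows "0 \<le> scaled_tensor a c t \<and> scaled_tensor a c t \<le> 1"
  unfolding scaled_tensor_def
  by (intro conjI prod_nonneg prod_le_1) (use factor_range[OF assms] in auto)

lemma scaled_tensor_eq_1:
  assumes "t \<in> orthant" "0 \<le> c" "c * infnorm t \<le> 1"
  shows "scaled_tensor a c t = 1"
  unfolding scaled_tensor_def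
proof (intro prod.neutral ballI eq_1)
  fix b :: 'a assume b: "b \<in> Basis"
  show "0 \<le> c * (t \<bullet> b)" using assms(2) orthant_inner[OF assms(1) b] by simp
  have "t \<bullet> b \<le> infnorm t" using infnorm_le_iff[of t "infnorm t"] b by auto
  hence "c * (t \<bullet> b) \<le> c * infnorm t" using assms(2) by (rule mult_left_mono)
  thus "c * (t \<bullet> b) \<le> 1" using assms(3) by linarith
qed

lemma scaled_tensor_eq_0:
  assumes "t \<in> orthant" "2 \<le> c * infnorm t"
  shows "scaled_tensor a c t = 0"
proof -
  obtain b where b: "b \<in> Basis" "\<bar>t \<bullet> b\<bar> = infnorm t" by (rule infnorm_attained)
  hence "a (c * (t \<bullet> b)) = 0" using assms orthant_inner[OF assms(1) b(1)] by (intro eq_0) simp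
  thus ?thesis unfolding scaled_tensor_def using b(1) by (intro prod_zero) auto
qed

text \<open>
  If the product does not already vanish because of its largest coordinate, that coordinate is below
  \<open>2 / c\<close>. A coordinate at most half as large then lies in the plateau where the factor is \<open>1 = a 0\<close>.
  In the other case the largest coordinate is not \<open>b\<close>, so it survives the projection and both sides
  vanish.
\<close>

lemma scaled_tensor_coord_proj:
  assumes t: "t \<in> orthant" and b: "b \<in> Basis" and c: "0 \<le> c" and small: "t \<bullet> b \<le> 1/2 * infnorm t"
  shows "scaled_tensor a c t = scaled_tensor a c (coord_proj b t)"
proof (cases "2 \<le> c * infnorm t")
  case True
  obtain b' where b': "b' \<in> Basis" "\<bar>t \<bullet> b'\<bar> = infnorm t" by (rule infnorm_attained)
  have "b' \<noteq> b"
    using small True b' orthant_inner[OF t b] infnorm_pos_le[of t] by auto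
  hence "\<bar>coord_proj b t \<bullet> b'\<bar> = infnorm t" using b b' by (simp add: inner_coord_proj)
  moreover have "\<bar>coord_proj b t \<bullet> b'\<bar> \<le> infnorm (coord_proj b t)"
    using infnorm_le_iff[of "coord_proj b t" "infnorm (coord_proj b t)"] b'(1) by simp
  ultimately have "2 \<le> c * infnorm (coord_proj b t)"
    using True c mult_left_mono[of "infnorm t" "infnorm (coord_proj b t)" c] by linarith
  thus ?thesis
    using scaled_tensor_eq_0[OF t True] scaled_tensor_eq_0[OF coord_proj_in_orthant[OF t b]] by simp
next
  case False
  have "c * (t \<bullet> b) \<le> c * (1/2 * infnorm t)" using small c by (rule mult_left_mono)
  hence "a (c * (t \<bullet> b)) = 1"
    using False c orthant_inner[OF t b] by (intro eq_1) auto
  moreover have "a 0 = 1" by (rule eq_1) auto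
  ultimately show ?thesis
    unfolding scaled_tensor_def using b by (intro prod.cong) (auto simp: inner_coord_proj)
qed

text \<open>
  Only one factor depends on the coordinate \<open>b\<close>, and the product of the others lies in \<open>[0,1]\<close>.
\<close>

lemma taylor_coeff_scaled_tensor:
  fixes t :: "'a::euclidean_space"
  assumes c: "0 \<le> c" and b: "b \<in> Basis" and t: "t \<in> orthant"
  shows "\<bar>taylor_coeff b (scaled_tensor a c) k t\<bar> \<le> c ^ k * \<bar>taylor_coeff 1 a k (c * (t \<bullet> b))\<bar>"
proof -
  let ?Q = "\<lambda>t::'a. \<Prod>b'\<in>Basis - {b}. a (c * (t \<bullet> b'))"
  have split: "scaled_tensor a c = (\<lambda>t. a (c * (t \<bullet> b)) * ?Q t)"
    unfolding scaled_tensor_def using b by (intro ext prod.remove) auto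
  have "?Q (upd x b s) = ?Q x" for x s
    using b by (intro prod.cong) (auto simp: inner_upd)
  hence "has_partial_deriv b ?Q (\<lambda>t. 0)" by (simp add: has_partial_deriv_def)
  from taylor_coeff_coord_mult[OF smooth this c b t]
  have "\<bar>taylor_coeff b (scaled_tensor a c) k t\<bar> = c ^ k * \<bar>taylor_coeff 1 a k (c * (t \<bullet> b))\<bar> * \<bar>?Q t\<bar>"
    using c by (simp add: split abs_mult)
  also have "\<dots> \<le> c ^ k * \<bar>taylor_coeff 1 a k (c * (t \<bullet> b))\<bar> * 1"
  proof (intro mult_left_mono)
    show "\<bar>?Q t\<bar> \<le> 1"
      unfolding abs_prod by (intro prod_le_1) (use factor_range[OF t c] in auto)
  qed (use c in auto)
  finally show ?thesis by simp
qed

lemma second_kind_a_scaled_tensor: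
  "second_kind_a (scaled_tensor a 1 :: 'a::euclidean_space \<Rightarrow> real)"
  unfolding second_kind_a_def
proof
  show "second_kind (scaled_tensor a 1 :: 'a \<Rightarrow> real)"
    by (rule second_kindI)
       (auto intro: scaled_tensor_smooth scaled_tensor_coord_proj scaled_tensor_eq_0)
  show "\<forall>t\<in>unit_ball_1::'a set. scaled_tensor a 1 t = 1"
  proof
    fix t :: 'a assume "t \<in> unit_ball_1"
    thus "scaled_tensor a 1 t = 1"
      using infnorm_le_of_unit_ball_1[of t]
      by (intro scaled_tensor_eq_1) (auto simp: unit_ball_1_def)
  qed
qed

section \<open>The band function\<close>

text \<open>
  The function of part (b). It lives on the shell \<open>1/2 \<le> infnorm t \<le> 2\<close>, and its two terms
  change on disjoint parts of that shell: the subtracted one inside the unit ball of \<open>infnorm\<close>, the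
  first one outside.
\<close>

definition band :: "'a::euclidean_space \<Rightarrow> real" where
  "band t = scaled_tensor a 1 t - scaled_tensor a 2 t"

lemma band_smooth: "smooth_on_orthant band"
  unfolding band_def by (intro smooth_on_orthant_diff scaled_tensor_smooth) auto

text \<open>
  A coordinate \<open>s\<close> satisfies \<open>s \<le> 1\<close>, where the derivatives of \<open>a s\<close> vanish, or
  \<open>2 s \<ge> 2\<close>, where those of \<open>a (2 s)\<close> vanish. Thus only one term contributes, and the bound needs
  no factor 2 in front. This sharpness is what makes the constant of part (c) come out.
\<close>

lemma taylor_coeff_band:
  fixes t :: "'a::euclidean_space"
  assumes "1 \<le> k" and b: "b \<in> Basis" and t: "t \<in> orthant"
    and bound: "\<And>s. 0 \<le> s \<Longrightarrow> \<bar>taylor_coeff 1 a k s\<bar> \<le> K"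
  shows "\<bar>taylor_coeff b band k t\<bar> \<le> 2 ^ k * K"
proof -
  have s: "0 \<le> t \<bullet> b" by (rule orthant_inner[OF t b])
  have K: "0 \<le> K" using bound[of 0] by simp
  have 1: "\<bar>taylor_coeff b (scaled_tensor a 1) k t\<bar> \<le> \<bar>taylor_coeff 1 a k (t \<bullet> b)\<bar>"
    using taylor_coeff_scaled_tensor[of 1 b t k] b t by simp
  have 2: "\<bar>taylor_coeff b (scaled_tensor a 2) k t\<bar> \<le> 2 ^ k * \<bar>taylor_coeff 1 a k (2 * (t \<bullet> b))\<bar>"
    using taylor_coeff_scaled_tensor[of 2 b t k] b t by simp
  have diff: "taylor_coeff b band k t =
      taylor_coeff b (scaled_tensor a 1) k t - taylor_coeff b (scaled_tensor a 2) k t"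
    unfolding band_def by (intro taylor_coeff_diff scaled_tensor_smooth b t) auto
  show ?thesis
  proof (cases "t \<bullet> b \<le> 1")
    case True
    hence "taylor_coeff 1 a k (t \<bullet> b) = 0" using assms(1) s by (intro taylor_coeff_eq_0) auto
    moreover have "2 ^ k * \<bar>taylor_coeff 1 a k (2 * (t \<bullet> b))\<bar> \<le> 2 ^ k * K"
      using bound[of "2 * (t \<bullet> b)"] s by simp
    ultimately show ?thesis using 1 2 unfolding diff by linarith
  next
    case False
    hence "taylor_coeff 1 a k (2 * (t \<bullet> b)) = 0" using assms(1) by (intro taylor_coeff_eq_0) auto
    moreover have "\<bar>taylor_coeff 1 a k (t \<bullet> b)\<bar> \<le> 2 ^ k * K"
      using bound[OF s] mult_right_mono[OF one_le_power[of "2::real" k] K] by simp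
    ultimately show ?thesis using 1 2 unfolding diff by simp
  qed
qed

lemma band_eq_0_outside: "t \<in> orthant \<Longrightarrow> infnorm t > 2 \<Longrightarrow> band t = 0"
  by (simp add: band_def scaled_tensor_eq_0)

lemma band_coord_proj:
  "t \<in> orthant \<Longrightarrow> b \<in> Basis \<Longrightarrow> t \<bullet> b \<le> 1/2 * infnorm t \<Longrightarrow> band t = band (coord_proj b t)"
  using scaled_tensor_coord_proj[of t b 1] scaled_tensor_coord_proj[of t b 2] by (simp add: band_def)

lemma band_eq_0_inside:
  assumes "t \<in> orthant" "infnorm t \<le> 1/2"
  shows "band t = 0"
  using assms by (simp add: band_def scaled_tensor_eq_1)

lemma half_unit_ball_1D:
  assumes "t \<in> (*\<^sub>R) (1/2) ` unit_ball_1"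
  shows "t \<in> orthant" "infnorm t \<le> 1/2"
proof -
  obtain u where u: "u \<in> unit_ball_1" "t = (1/2) *\<^sub>R u" using assms by auto
  thus "t \<in> orthant" by (simp add: unit_ball_1_def orthant_scaleR)
  show "infnorm t \<le> 1/2" using u infnorm_le_of_unit_ball_1[OF u(1)] by (simp add: infnorm_mul)
qed

text \<open>
  Parts (b) and (c) use this with \<open>\<phi> x = x\<close> and \<open>\<phi> x = sin (\<pi> x / 2)\<close>.
\<close>

lemma second_kind_b_compose_band:
  assumes "smooth_on_orthant (\<lambda>t::'a::euclidean_space. \<phi> (band t))" "\<phi> 0 = 0"
  shows "second_kind_b (\<lambda>t::'a. \<phi> (band t))"
  unfolding second_kind_b_def
proof
  show "second_kind (\<lambda>t::'a. \<phi> (band t))"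
    by (rule second_kindI[OF assms(1)])
       (simp add: assms(2) band_eq_0_outside, metis band_coord_proj)
  show "\<forall>t\<in>(*\<^sub>R) (1/2) ` unit_ball_1. \<phi> (band t) = 0"
    using half_unit_ball_1D band_eq_0_inside assms(2) by metis
qed

text \<open>
  Let \<open>x j\<close> be the tensor product at \<open>2^(1-j) t\<close>. The band at \<open>2^(-j) t\<close> is
  \<open>x (j+1) - x j\<close>, and on the dyadic sequence one of \<open>x j = 0\<close>, \<open>x (j+1) = 1\<close> always holds (the first if \<open>2^(1-j) * infnorm t \<ge> 2\<close>, the second otherwise). In
  either case
  \<open>sin\<^sup>2 (\<pi>/2 (x (j+1) - x j)) = sin\<^sup>2 (\<pi>/2 x (j+1)) - sin\<^sup>2 (\<pi>/2 x j)\<close>; in the second case this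
  is \<open>cos\<^sup>2 = 1 - sin\<^sup>2\<close>. The sum telescopes from \<open>x 0 = 0\<close> to the eventual value 1.
\<close>

lemma band_partition_of_unity:
  assumes t: "t \<in> orthant" "1 \<le> infnorm t"
  shows "(\<lambda>j. (sin (pi / 2 * band ((1 / 2 ^ j) *\<^sub>R t)))\<^sup>2) sums 1"
proof -
  define x where "x j = scaled_tensor a (2 / 2 ^ j) t" for j :: nat
  define f where "f j = (sin (pi / 2 * x j))\<^sup>2" for j
  have "(sin (pi / 2 * band ((1 / 2 ^ j) *\<^sub>R t)))\<^sup>2 = f (Suc j) - f j" for j
  proof -
    have band: "band ((1 / 2 ^ j) *\<^sub>R t) = x (Suc j) - x j"
      by (simp add: band_def x_def scaled_tensor_scaleR)
    have "x j = 0 \<or> x (Suc j) = 1"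
    proof (cases "2 \<le> 2 / 2 ^ j * infnorm t")
      case True
      thus ?thesis unfolding x_def using scaled_tensor_eq_0[OF t(1) True] by simp
    next
      case False
      hence "2 / 2 ^ Suc j * infnorm t \<le> 1" by (simp add: field_simps)
      thus ?thesis unfolding x_def using scaled_tensor_eq_1[OF t(1), of "2 / 2 ^ Suc j"] by simp
    qed
    thus ?thesis
    proof
      assume "x (Suc j) = 1"
      hence "sin (pi / 2 * band ((1 / 2 ^ j) *\<^sub>R t)) = cos (pi / 2 * x j)"
        unfolding band by (simp add: right_diff_distrib sin_diff)
      thus ?thesis using \<open>x (Suc j) = 1\<close> by (simp add: f_def cos_squared_eq)
    qed (simp add: band f_def)
  qed
  moreover have "f \<longlonglongrightarrow> 1"
  proof (rule tendsto_eventually)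
    have "(\<lambda>j. 2 * infnorm t * (1 / 2) ^ j) \<longlonglongrightarrow> 2 * infnorm t * 0"
      by (intro tendsto_intros) auto
    hence "\<forall>\<^sub>F j in sequentially. 2 * infnorm t * (1 / 2) ^ j < 1"
      by (rule order_tendstoD(2)) simp
    thus "\<forall>\<^sub>F j in sequentially. f j = 1"
    proof eventually_elim
      case (elim j)
      hence "x j = 1"
        unfolding x_def by (intro scaled_tensor_eq_1 t(1)) (auto simp: power_divide mult_ac)
      thus ?case by (simp add: f_def)
    qed
  qed
  moreover have "f 0 = 0" using t by (simp add: f_def x_def scaled_tensor_eq_0)
  ultimately show ?thesis using telescope_sums[of f 1] by simp
qed

text \<open>
  The case distinction of part (c) dissolves: for \<open>infnorm t \<le> 1\<close> the first term of the band is 1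
  and \<open>sin (\<pi>/2 (1 - x)) = cos (\<pi>/2 x)\<close>, while for \<open>infnorm t \<ge> 1\<close> the second term is 0. Smoothness
  across the boundaries of the cases is then clear.
\<close>

lemma sin_band_cases:
  assumes t: "t \<in> orthant"
  shows "(if t \<in> (*\<^sub>R) (1/2) ` unit_ball_inf then 0
          else if t \<in> unit_ball_inf then cos (pi / 2 * scaled_tensor a 2 t)
          else if t \<in> (*\<^sub>R) 2 ` unit_ball_inf then sin (pi / 2 * scaled_tensor a 1 t)
          else 0) = sin (pi / 2 * band t)"
proof -
  have ball: "t \<in> (*\<^sub>R) (1/2) ` unit_ball_inf \<longleftrightarrow> infnorm t \<le> 1/2"
    "t \<in> unit_ball_inf \<longleftrightarrow> infnorm t \<le> 1"
    "t \<in> (*\<^sub>R) 2 ` unit_ball_inf \<longleftrightarrow> infnorm t \<le> 2"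
    using t by (auto simp: scaleR_image_iff unit_ball_inf_def orthant_scaleR infnorm_mul)
  consider "infnorm t \<le> 1/2" | "1/2 < infnorm t" "infnorm t \<le> 1"
    | "1 < infnorm t" "infnorm t \<le> 2" | "2 < infnorm t" by linarith
  thus ?thesis
  proof cases
    case 1
    thus ?thesis using band_eq_0_inside[OF t] by (simp add: ball)
  next
    case 2
    hence "scaled_tensor a 1 t = 1" using t by (intro scaled_tensor_eq_1) auto
    thus ?thesis using 2 by (simp add: ball band_def right_diff_distrib sin_diff)
  next
    case 3
    hence "scaled_tensor a 2 t = 0" using t by (intro scaled_tensor_eq_0) auto
    thus ?thesis using 3 by (simp add: ball band_def)
  next
    case 4
    thus ?thesis using band_eq_0_outside[OF t] by (simp add: ball)
  qed
qed

end

section \<open>The three cutoff functions\<close>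

theorem theorem3p16:
  fixes L :: "real \<Rightarrow> real"
    and M \<gamma> \<beta> :: real
    and a :: "real \<Rightarrow> real"
    and A B C :: "'a::euclidean_space \<Rightarrow> real"
  assumes "\<And>t. t \<ge> 0 \<Longrightarrow> L t \<ge> 1"
    and "mono_on {0..} L"
    and "L 0 = 1"
    and "set_integrable lborel {0..} (\<lambda>t. 1 / ((t + 1) * L t))"
    and "M = 1 + (LINT t:{0..}|lborel. 1 / ((t + 1) * L t))"
    and "convex_on {0..} (\<lambda>t. (t + 1) * ln (L t))"
    and "\<gamma> > 0" and "\<beta> > 0"
    and "a \<in> smooth_class L \<gamma> (\<beta> * M)"
    and "admissible_univariate_a a"
    and "\<And>t. t \<ge> 0 \<Longrightarrow> 0 \<le> a t \<and> a t \<le> 1"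
    and "\<And>t. t \<in> orthant \<Longrightarrow> A t = (\<Prod>b\<in>Basis. a (t \<bullet> b))"
    and "\<And>t. t \<in> orthant \<Longrightarrow>
           B t = (\<Prod>b\<in>Basis. a (t \<bullet> b)) - (\<Prod>b\<in>Basis. a (2 * (t \<bullet> b)))"
    and "\<And>t. t \<in> orthant \<Longrightarrow>
           C t = (if t \<in> (*\<^sub>R) (1/2) ` unit_ball_inf then 0
                  else if t \<in> unit_ball_inf then cos (pi / 2 * A (2 *\<^sub>R t))
                  else if t \<in> (*\<^sub>R) 2 ` unit_ball_inf then sin (pi / 2 * A t)
                  else 0)"
  shows "(second_kind_a A \<and> A \<in> smooth_class L \<gamma> (\<beta> * M))
       \<and> (second_kind_b B \<and> B \<in> smooth_class L (2 * \<gamma>) (2 * \<beta> * M))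
       \<and> (second_kind_c C \<and> C \<in> smooth_class L 1 ((pi * \<gamma> + 2) * \<beta> * M))"
proof -
  interpret univariate_cutoff a
    using assms(10,11) by unfold_locales auto
  have A: "A t = scaled_tensor a 1 t" if "t \<in> orthant" for t
    using assms(12)[OF that] by (simp add: scaled_tensor_def)
  have B: "B t = band t" if "t \<in> orthant" for t
    using assms(13)[OF that] by (simp add: band_def scaled_tensor_def)
  have C: "C t = sin (pi / 2 * band t)" if t: "t \<in> orthant" for t
  proof -
    have "A (2 *\<^sub>R t) = scaled_tensor a 2 t"
      using A[of "2 *\<^sub>R t"] t by (simp add: orthant_scaleR scaled_tensor_scaleR)
    thus ?thesis using assms(14)[OF t] sin_band_cases[OF t] A[OF t] by (simp only:)
  qed

  have "0 \<le> M"
  proof -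
    have "0 \<le> (LINT t:{0..}|lborel. 1 / ((t + 1) * L t))"
      unfolding set_lebesgue_integral_def
    proof (rule Bochner_Integration.integral_nonneg)
      fix t :: real
      show "0 \<le> indicator {0..} t *\<^sub>R (1 / ((t + 1) * L t))"
        using assms(1)[of t] by (cases "0 \<le> t") auto
    qed
    thus ?thesis using assms(5) by simp
  qed
  define r where "r = \<beta> * M"
  have r: "0 \<le> r" using \<open>0 \<le> M\<close> \<open>\<beta> > 0\<close> by (simp add: r_def)
  have L: "0 \<le> L t" if "0 \<le> t" for t using assms(1)[OF that] by linarith
  have a_bound: "\<bar>taylor_coeff 1 a k s\<bar> \<le> \<gamma> * (r * L (real k - 1)) ^ k" if "1 \<le> k" "0 \<le> s" for k s
    using assms(9) that unfolding smooth_class_iff r_def by (auto simp: orthant_real)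
  \<comment> \<open>This follows from \<open>a 0 = 1\<close>. It turns the uniform bound 1 for the tensor products into the
    uniform bounds demanded in parts (a) and (b).\<close>
  have "1 \<le> \<gamma>"
  proof -
    have "\<bar>a 0\<bar> \<le> \<gamma>" using assms(9) unfolding smooth_class_iff by (auto simp: orthant_real)
    thus ?thesis using eq_1[of 0] by simp
  qed
  have band_bound: "\<bar>taylor_coeff b (band :: 'a \<Rightarrow> real) k t\<bar> \<le> \<gamma> * (2 * r * L (real k - 1)) ^ k"
    if "1 \<le> k" "b \<in> Basis" "t \<in> orthant" for k b t
    using taylor_coeff_band[OF that a_bound[OF that(1)]] by (simp add: power_mult_distrib mult_ac)

  have "scaled_tensor a 1 \<in> (smooth_class L \<gamma> r :: ('a \<Rightarrow> real) set)"
    unfolding smooth_class_iff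
  proof (intro conjI ballI allI impI)
    show "smooth_on_orthant (scaled_tensor a 1 :: 'a \<Rightarrow> real)" by (rule scaled_tensor_smooth) simp
    show "\<bar>scaled_tensor a 1 t\<bar> \<le> \<gamma>" if "t \<in> orthant" for t :: 'a
      using scaled_tensor_range[OF that, of 1] \<open>1 \<le> \<gamma>\<close> by simp
    show "\<bar>taylor_coeff b (scaled_tensor a 1) k t\<bar> \<le> \<gamma> * (r * L (real k - 1)) ^ k"
      if "1 \<le> k" "b \<in> Basis" "t \<in> orthant" for k and b t :: 'a
      using taylor_coeff_scaled_tensor[of 1 b t k] a_bound[OF that(1), of "t \<bullet> b"]
        orthant_inner[OF that(3,2)] that by simp
  qed
  hence A_class: "A \<in> smooth_class L \<gamma> (\<beta> * M)" using A by (auto simp: r_def intro: smooth_class_cong)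
  have A_kind: "second_kind_a A"
    using second_kind_a_cong[OF A second_kind_a_scaled_tensor] .

  have "band \<in> (smooth_class L (2 * \<gamma>) (2 * r) :: ('a \<Rightarrow> real) set)"
    unfolding smooth_class_iff
  proof (intro conjI ballI allI impI)
    show "smooth_on_orthant (band :: 'a \<Rightarrow> real)" by (rule band_smooth)
    show "\<bar>band t\<bar> \<le> 2 * \<gamma>" if "t \<in> orthant" for t :: 'a
      using scaled_tensor_range[OF that, of 1] scaled_tensor_range[OF that, of 2] \<open>1 \<le> \<gamma>\<close>
      unfolding band_def by linarith
    show "\<bar>taylor_coeff b band k t\<bar> \<le> 2 * \<gamma> * (2 * r * L (real k - 1)) ^ k"
      if "1 \<le> k" "b \<in> Basis" "t \<in> orthant" for k and b t :: 'a
      using band_bound[OF that] by simp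
  qed
  hence B_class: "B \<in> smooth_class L (2 * \<gamma>) (2 * \<beta> * M)"
    using B by (auto simp: r_def mult_ac intro: smooth_class_cong)
  have B_kind: "second_kind_b B"
    using second_kind_b_cong[OF B second_kind_b_compose_band[of "\<lambda>x. x"]] band_smooth by simp

  have half: "smooth_on_orthant (\<lambda>t::'a. pi / 2 * band t)"
    by (intro smooth_on_orthant_mult smooth_on_orthant_const band_smooth)
  have "(\<lambda>t. sin (pi / 2 * band t)) \<in> (smooth_class L 1 ((1 + pi / 2 * \<gamma>) * (2 * r)) :: ('a \<Rightarrow> real) set)"
    unfolding smooth_class_iff
  proof (intro conjI ballI allI impI)
    show "smooth_on_orthant (\<lambda>t::'a. sin (pi / 2 * band t))" by (rule smooth_on_orthant_sin[OF half])
    fix k :: nat and b t :: 'a assume k: "1 \<le> k" and b: "b \<in> Basis" and t: "t \<in> orthant"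
    have "\<bar>taylor_coeff b (\<lambda>t. pi / 2 * band t) k t\<bar> \<le> pi / 2 * \<gamma> * (2 * r * L (real k - 1)) ^ k"
      if "1 \<le> k" for k
      using mult_left_mono[OF band_bound[OF that b t], of "pi / 2"]
      unfolding taylor_coeff_cmult[OF band_smooth b t] by (simp add: abs_mult mult_ac)
    \<comment> \<open>The bound applies with \<open>c = \<pi> \<gamma> / 2\<close> and the doubled scale \<open>2 \<beta> M\<close>:
      \<open>(1 + \<pi> \<gamma> / 2) 2 = \<pi> \<gamma> + 2\<close>.\<close>
    from taylor_coeff_sin_cos_bound[OF half b t assms(2) L _ _ this, of k]
    show "\<bar>taylor_coeff b (\<lambda>t. sin (pi / 2 * band t)) k t\<bar>
        \<le> 1 * ((1 + pi / 2 * \<gamma>) * (2 * r) * L (real k - 1)) ^ k"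
      using r \<open>\<gamma> > 0\<close> by simp
  qed simp
  moreover have "(1 + pi / 2 * \<gamma>) * (2 * r) = (pi * \<gamma> + 2) * \<beta> * M"
    by (simp add: r_def algebra_simps)
  ultimately have C_class: "C \<in> smooth_class L 1 ((pi * \<gamma> + 2) * \<beta> * M)"
    using C by (auto intro: smooth_class_cong)
  have C_kind: "second_kind_c C"
    unfolding second_kind_c_def
  proof (intro conjI ballI)
    show "second_kind_b C"
      using second_kind_b_cong[OF C second_kind_b_compose_band[of "\<lambda>x. sin (pi / 2 * x)"]]
        smooth_on_orthant_sin[OF half] by simp
    fix t :: 'a assume "t \<in> orthant - {t \<in> orthant. \<forall>b\<in>Basis. t \<bullet> b < 1}"
    then obtain b where t: "t \<in> orthant" and b: "b \<in> Basis" "1 \<le> t \<bullet> b"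
      by (auto simp: not_less)
    have "1 \<le> infnorm t" using infnorm_le_iff[of t "infnorm t"] b by force
    from band_partition_of_unity[OF t this]
    show "(\<lambda>j. \<bar>C ((1 / 2 ^ j) *\<^sub>R t)\<bar>\<^sup>2) sums 1"
      using t by (simp add: C orthant_scaleR)
  qed
  show ?thesis
    using A_kind A_class B_kind B_class C_kind C_class by blast
qed

end
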